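(* Let $W_n$ be the wheel graph on $n+1$ vertices. If $n$ is even, then the total domination number of $W_n$ can increase (by deleting edges) by at most $n-2$, and $$b_t^{n-2}(W_n)=2n-\frac{n+4}{2}.$$ If $n$ is odd, then the total domination number can increase by at most $n-1$, and $$b_t^{n-1}(W_n)=2n-\frac{n+1}{2}.$$
   Context: The wheel $W_n$ is the graph on $n+1$ vertices obtained by joining a single vertex to every vertex of a cycle $C_n$; it has $2n$ edges and $\gamma_t(W_n)=2$. A total dominating set of a graph without isolated vertices is a vertex set $S$ such that every vertex is adjacent to some vertex of $S$; $\gamma_t(G)$ is the minimum size of such a set. The $k$-total bondage number $b_t^k(G)$ is the minimum number of edges that must be deleted from $G$ so that the resulting graph (required to have no isolated vertices) has total domination number at least $\gamma_t(G)+k$. *)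

theory Defs
  imports Main "HOL-Library.Extended_Nat"
begin

text \<open>Finite simple graphs: a vertex set together with a set of two-element vertex sets.\<close>

datatype 'a graph = Graph (verts: "'a set") (edges: "'a set set")

definition adjacent :: "'a graph \<Rightarrow> 'a \<Rightarrow> 'a \<Rightarrow> bool" where
  "adjacent G u v \<longleftrightarrow> {u, v} \<in> edges G"

definition no_isolated :: "'a graph \<Rightarrow> bool" where
  "no_isolated G \<longleftrightarrow> (\<forall>v\<in>verts G. \<exists>u\<in>verts G. adjacent G u v)"

definition delete_edges :: "'a graph \<Rightarrow> 'a set set \<Rightarrow> 'a graph" where
  "delete_edges G B = Graph (verts G) (edges G - B)"

definition total_dominating :: "'a graph \<Rightarrow> 'a set \<Rightarrow> bool" where
  "total_dominating G S \<longleftrightarrow> S \<subseteq> verts G \<and> (\<forall>v\<in>verts G. \<exists>u\<in>S. adjacent G u v)"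

text \<open>Meaningful only for finite graphs without isolated vertices; otherwise the minimum may be
  taken over the empty set.\<close>

definition total_domination_number :: "'a graph \<Rightarrow> nat" where
  "total_domination_number G = Min (card ` {S. total_dominating G S})"

text \<open>The value is infinite when no admissible set of edges exists, so an equation with a finite
  value includes the existence of such a set.\<close>

definition total_bondage_number :: "nat \<Rightarrow> 'a graph \<Rightarrow> enat" where
  "total_bondage_number k G =
     (INF B \<in> {B. B \<subseteq> edges G \<and> no_isolated (delete_edges G B) \<and>
                  total_domination_number (delete_edges G B) \<ge> total_domination_number G + k}.
        enat (card B))"

definition cycle_edges :: "nat \<Rightarrow> nat set set" where
  "cycle_edges n = {{i, Suc i mod n} | i. i < n}"

text \<open>The rim vertices are \<open>0, \<dots>, n - 1\<close> and the hub is \<open>n\<close>; this is the wheel for \<open>n \<ge> 3\<close>.\<close>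

definition wheel :: "nat \<Rightarrow> nat graph" where
  "wheel n = Graph {0..n} (cycle_edges n \<union> {{n, i} | i. i < n})"

end

theory Submission
  imports Defs
begin

text \<open>
  Let \<open>H\<close> have \<open>N\<close> vertices and no isolated vertex. If \<open>\<gamma>\<^sub>t(H) = N\<close>, then no \<open>V - {v}\<close> is total
  dominating, so each \<open>v\<close> is the only neighbour of some vertex; this assignment is injective, hence
  bijective, and \<open>H\<close> is a perfect matching. If \<open>\<gamma>\<^sub>t(H) \<ge> N - 1\<close>, then for \<open>v \<noteq> w\<close> some vertex has
  its neighbourhood inside \<open>{v, w}\<close>. Let \<open>k\<close> be the number of vertices that are not the only
  neighbour of some vertex. The \<open>N - k\<close> singletons of the others and the \<open>k choose 2\<close> pairs of
  these are then neighbourhoods of distinct vertices, which forces \<open>k \<le> 3\<close>, leaves at most one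
  vertex unaccounted for, and bounds the degree sum by \<open>N + 3\<close>. The extremal spanning subgraphs of
  the wheel are a perfect matching, and a triangle through the hub plus a matching.
\<close>

section \<open>Graphs with large total domination number\<close>

text \<open>The type \<open>graph\<close> admits loops, larger edges and edges leaving the vertex
  set; this predicate excludes them.\<close>

definition simple_graph :: "'a graph \<Rightarrow> bool" where
  "simple_graph G \<longleftrightarrow> finite (verts G) \<and> (\<forall>e\<in>edges G. e \<subseteq> verts G \<and> card e = 2)"

definition nbrs :: "'a graph \<Rightarrow> 'a \<Rightarrow> 'a set" where
  "nbrs G v = {u. adjacent G u v}"

lemma simple_graph_finite_edges:
  assumes "simple_graph G"
  shows "finite (edges G)"
  by (rule finite_subset[of _ "Pow (verts G)"]) (use assms in \<open>auto simp: simple_graph_def\<close>)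

lemma adjacent_commute: "adjacent G u v \<longleftrightarrow> adjacent G v u"
  by (simp add: adjacent_def insert_commute)

lemma adjacent_imp:
  assumes "simple_graph G" "adjacent G u v"
  shows "u \<in> verts G" "v \<in> verts G" "u \<noteq> v"
  using assms unfolding simple_graph_def adjacent_def by fastforce+

lemma nbrs_nonempty: "no_isolated G \<Longrightarrow> v \<in> verts G \<Longrightarrow> nbrs G v \<noteq> {}"
  by (auto simp: nbrs_def no_isolated_def)

text \<open>Incidences are counted twice: at \<open>v\<close> they correspond to neighbours via
  \<open>u\<close> to \<open>{u, v}\<close>, and every edge has exactly two endpoints in
  \<open>verts G\<close>.\<close>

lemma handshake:
  assumes "simple_graph G"
  shows "(\<Sum>v\<in>verts G. card (nbrs G v)) = 2 * card (edges G)"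
proof -
  have "card (nbrs G v) = card {e \<in> edges G. v \<in> e}" for v
  proof (rule bij_betw_same_card)
    show "bij_betw (\<lambda>u. {u, v}) (nbrs G v) {e \<in> edges G. v \<in> e}"
      unfolding bij_betw_def
    proof
      show "inj_on (\<lambda>u. {u, v}) (nbrs G v)"
        by (auto simp: inj_on_def doubleton_eq_iff)
      show "(\<lambda>u. {u, v}) ` nbrs G v = {e \<in> edges G. v \<in> e}"
      proof
        show "{e \<in> edges G. v \<in> e} \<subseteq> (\<lambda>u. {u, v}) ` nbrs G v"
        proof
          fix e assume e: "e \<in> {e \<in> edges G. v \<in> e}"
          then have "card e = 2" using assms by (simp add: simple_graph_def)
          then obtain a b where "e = {a, b}" by (auto simp: card_2_iff)
          with e obtain u where "e = {u, v}" by (auto simp: insert_commute)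
          with e show "e \<in> (\<lambda>u. {u, v}) ` nbrs G v"
            by (auto simp: nbrs_def adjacent_def)
        qed
      qed (auto simp: nbrs_def adjacent_def)
    qed
  qed
  moreover have "(\<Sum>v\<in>verts G. card {e \<in> edges G. v \<in> e}) = 2 * card (edges G)"
  proof (rule sum_multicount)
    have "{v \<in> verts G. v \<in> e} = e" if "e \<in> edges G" for e
      using assms that by (auto simp: simple_graph_def)
    then show "\<forall>e\<in>edges G. card {v \<in> verts G. v \<in> e} = 2"
      using assms by (simp add: simple_graph_def)
  qed (use assms simple_graph_finite_edges in \<open>auto simp: simple_graph_def\<close>)
  ultimately show ?thesis by simp
qed

section \<open>Total dominating sets and their minimum size\<close>

lemma finite_total_dominating: "finite (verts G) \<Longrightarrow> finite {S. total_dominating G S}"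
  by (rule finite_subset[of _ "Pow (verts G)"]) (auto simp: total_dominating_def)

lemma total_domination_number_le:
  assumes "finite (verts G)" "total_dominating G S"
  shows "total_domination_number G \<le> card S"
  unfolding total_domination_number_def
  using assms finite_total_dominating by (intro Min_le) auto

lemma total_dominating_verts: "no_isolated G \<Longrightarrow> total_dominating G (verts G)"
  by (auto simp: no_isolated_def total_dominating_def)

lemma total_domination_number_ge:
  assumes "finite (verts G)" "no_isolated G" "\<And>S. total_dominating G S \<Longrightarrow> m \<le> card S"
  shows "m \<le> total_domination_number G"
  unfolding total_domination_number_def
  using assms finite_total_dominating total_dominating_verts
  by (subst Min_ge_iff) auto

text \<open>Otherwise every vertex keeps a neighbour outside \<open>X\<close>, and
  \<open>verts G - X\<close> is a total dominating set that is too small. It is applied to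
  singletons and to pairs.\<close>

lemma ex_nbrs_subset:
  assumes G: "simple_graph G" and X: "X \<subseteq> verts G"
    and large: "card (verts G) < total_domination_number G + card X"
  shows "\<exists>u\<in>verts G. nbrs G u \<subseteq> X"
proof (rule ccontr)
  assume *: "\<not> ?thesis"
  have fin: "finite (verts G)" using G by (simp add: simple_graph_def)
  have "total_dominating G (verts G - X)"
    unfolding total_dominating_def
  proof (intro conjI ballI)
    fix v assume "v \<in> verts G"
    with * obtain u where "u \<in> nbrs G v" "u \<notin> X" by blast
    then show "\<exists>u\<in>verts G - X. adjacent G u v"
      using adjacent_imp(1)[OF G, of u v] by (auto simp: nbrs_def)
  qed auto
  then have "total_domination_number G \<le> card (verts G - X)"
    using fin total_domination_number_le by blast
  also have "\<dots> = card (verts G) - card X"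
    using X fin by (meson card_Diff_subset finite_subset)
  \<comment> \<open>The subtraction on \<open>nat\<close> is exact because
    \<open>card X \<le> card (verts G)\<close>.\<close>
  finally show False
    using large card_mono[OF fin X] by linarith
qed

text \<open>The choice of \<open>f v\<close> with neighbourhood \<open>{v}\<close> permutes the
  vertices, so every degree is 1 and the handshake lemma gives the count. The equation also shows
  that the number of vertices is even.\<close>

lemma card_edges_if_total_domination_number_max:
  assumes G: "simple_graph G" and iso: "no_isolated G"
    and large: "card (verts G) \<le> total_domination_number G"
  shows "2 * card (edges G) = card (verts G)"
proof -
  have fin: "finite (verts G)" using G by (simp add: simple_graph_def)
  have "\<forall>v\<in>verts G. \<exists>u\<in>verts G. nbrs G u = {v}"
  proof
    fix v assume "v \<in> verts G"
    then obtain u where "u \<in> verts G" "nbrs G u \<subseteq> {v}"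
      using ex_nbrs_subset[OF G, of "{v}"] large by auto
    then show "\<exists>u\<in>verts G. nbrs G u = {v}"
      using nbrs_nonempty[OF iso] by blast
  qed
  then obtain f where f: "\<And>v. v \<in> verts G \<Longrightarrow> f v \<in> verts G \<and> nbrs G (f v) = {v}"
    by metis
  have inj: "inj_on f (verts G)"
    using f by (metis inj_onI singleton_inject)
  then have "f ` verts G = verts G"
    using f fin by (intro endo_inj_surj) auto
  then have "(\<Sum>v\<in>verts G. card (nbrs G v)) = (\<Sum>v\<in>verts G. card (nbrs G (f v)))"
    using sum.reindex[OF inj, of "\<lambda>v. card (nbrs G v)"] by simp
  also have "\<dots> = card (verts G)"
    using f by simp
  finally show ?thesis
    using handshake[OF G] by simp
qed

text \<open>The degree sum is split into the vertices \<open>h p\<close>, whose neighbourhoods are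
  the prescribed sets \<open>p\<close>, and the remaining vertices \<open>R\<close>, of which there
  is at most one. The excess 3 comes from \<open>k = 3\<close>, where all three pairs of a 3-set are
  neighbourhoods, as in a triangle.\<close>

lemma card_edges_if_total_domination_number_near_max:
  assumes G: "simple_graph G" and iso: "no_isolated G"
    and large: "card (verts G) \<le> total_domination_number G + 1"
  shows "2 * card (edges G) \<le> card (verts G) + 3"
proof -
  define V where "V = verts G"
  have fin: "finite V" using G by (simp add: simple_graph_def V_def)
  define A where "A = {v \<in> V. \<exists>u\<in>V. nbrs G u = {v}}"
  define K where "K = V - A"
  define k where "k = card K"
  define Q where "Q = {p. p \<subseteq> K \<and> card p = 2}"
  define P where "P = (\<lambda>v. {v}) ` A \<union> Q"
  have AV: "A \<subseteq> V" and KV: "K \<subseteq> V" by (auto simp: A_def K_def)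
  then have finA: "finite A" and finK: "finite K" using fin finite_subset by auto
  have finQ: "finite Q" unfolding Q_def by (rule finite_subset[of _ "Pow K"]) (use finK in auto)
  have disj: "(\<lambda>v. {v}) ` A \<inter> Q = {}" by (auto simp: Q_def)
  have cA: "card A + k = card V"
    using card_Diff_subset[OF finA AV] card_mono[OF fin AV] by (simp add: k_def K_def)
  have cQ: "card Q = k choose 2"
    unfolding Q_def k_def using n_subsets[OF finK] by simp
  have finP: "finite P" using finA finQ by (simp add: P_def)
  have cP: "card P = card A + (k choose 2)"
    unfolding P_def using finA finQ disj by (simp add: card_Un_disjoint card_image cQ)
  have "\<forall>p\<in>P. \<exists>u\<in>V. nbrs G u = p"
  proof
    fix p assume "p \<in> P"
    then consider v where "v \<in> A" "p = {v}" | "p \<in> Q" by (auto simp: P_def)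
    then show "\<exists>u\<in>V. nbrs G u = p"
    proof cases
      case 1
      then show ?thesis by (auto simp: A_def)
    next
      case 2
      then obtain v w where p: "p = {v, w}" "v \<in> K" "w \<in> K"
        by (auto simp: Q_def card_2_iff)
      have "p \<subseteq> verts G" "card p = 2" using 2 KV by (auto simp: Q_def V_def)
      then obtain u where u: "u \<in> V" "nbrs G u \<subseteq> p"
        using ex_nbrs_subset[OF G, of p] large by (auto simp: V_def)
      \<comment> \<open>A nonempty subset of \<open>{v, w}\<close> that is neither singleton is the
        whole pair; the singletons are excluded because \<open>v\<close> and \<open>w\<close> lie
        outside \<open>A\<close>.\<close>
      have "nbrs G u \<noteq> {}" using u nbrs_nonempty[OF iso] by (simp add: V_def)
      moreover have "nbrs G u \<noteq> {v}" "nbrs G u \<noteq> {w}"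
        using p u by (auto simp: K_def A_def)
      ultimately have "nbrs G u = p" using u p by blast
      with u show ?thesis by blast
    qed
  qed
  then obtain h where h: "\<And>p. p \<in> P \<Longrightarrow> h p \<in> V \<and> nbrs G (h p) = p"
    by metis
  \<comment> \<open>The set \<open>p\<close> is recovered from \<open>h p\<close> as its
    neighbourhood.\<close>
  have inj: "inj_on h P" using h by (metis inj_onI)
  have hV: "h ` P \<subseteq> V" using h by auto
  define R where "R = V - h ` P"
  have cR: "card R + card P = card V"
    using card_Diff_subset[of "h ` P" V] card_mono[OF fin hV] finP hV
    by (simp add: R_def card_image[OF inj])
  \<comment> \<open>Injectivity of \<open>h\<close> gives \<open>card P \<le> card V\<close>, that
    is, \<open>card A + (k choose 2) \<le> card A + k\<close>.\<close>
  then have k2: "(k choose 2) \<le> k" using cA cP by linarith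
  have k3: "k \<le> 3"
  proof (rule ccontr)
    assume "\<not> k \<le> 3"
    \<comment> \<open>For \<open>k \<ge> 4\<close> the factor \<open>k - 1\<close> is at least 3, so
      \<open>k choose 2\<close> is at least \<open>3 * k div 2\<close>, which exceeds
      \<open>k\<close>.\<close>
    then have "k * 3 \<le> k * (k - 1)" by (intro mult_le_mono2) auto
    then have "k * 3 div 2 \<le> k choose 2" unfolding choose_two by (rule div_le_mono)
    with k2 \<open>\<not> k \<le> 3\<close> show False by linarith
  qed
  then have cases: "k = 0 \<and> k choose 2 = 0 \<or> k = 1 \<and> k choose 2 = 0 \<or>
      k = 2 \<and> k choose 2 = 1 \<or> k = 3 \<and> k choose 2 = 3"
    by (auto simp: choose_two numeral_eq_Suc le_Suc_eq)
  have "(\<Sum>p\<in>P. card p) = card A + 2 * (k choose 2)"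
  proof -
    have "(\<Sum>p\<in>P. card p) = (\<Sum>p\<in>(\<lambda>v. {v}) ` A. card p) + (\<Sum>p\<in>Q. card p)"
      unfolding P_def using finA finQ disj by (intro sum.union_disjoint) auto
    also have "(\<Sum>p\<in>(\<lambda>v. {v}) ` A. card p) = card A" by (subst sum.reindex) auto
    also have "(\<Sum>p\<in>Q. card p) = (\<Sum>p\<in>Q. 2)" by (rule sum.cong) (auto simp: Q_def)
    finally show ?thesis by (simp add: cQ)
  qed
  moreover have "(\<Sum>v\<in>h ` P. card (nbrs G v)) = (\<Sum>p\<in>P. card p)"
    using h by (subst sum.reindex[OF inj]) auto
  moreover have "(\<Sum>v\<in>R. card (nbrs G v)) \<le> card R * (1 + (k choose 2))"
  proof (cases "R = {}")
    case False
    \<comment> \<open>The cardinality of \<open>R\<close> is \<open>k - (k choose 2)\<close>, which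
      is 0, 1, 1, 0 for \<open>k\<close> = 0, 1, 2, 3.\<close>
    have "card R \<le> 1" using cR cA cP cases by linarith
    with False obtain x where x: "R = {x}"
      by (metis R_def card_0_eq card_1_singletonE fin finite_Diff less_one nat_less_le)
    \<comment> \<open>A neighbour \<open>u\<close> of \<open>x\<close> differs from
      \<open>x\<close>, so it is some \<open>h p\<close>, and \<open>x\<close> lies in its
      neighbourhood \<open>p\<close>. Such a \<open>p\<close> is \<open>{x}\<close> or a pair in
      \<open>Q\<close>.\<close>
    have "nbrs G x \<subseteq> h ` insert {x} Q"
    proof
      fix u assume u: "u \<in> nbrs G x"
      then have "u \<noteq> x" "u \<in> V" "x \<in> nbrs G u"
        using adjacent_imp[OF G] adjacent_commute[of G] by (auto simp: nbrs_def V_def)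
      with x obtain p where "p \<in> P" "u = h p" "x \<in> p"
        using h R_def by blast
      then show "u \<in> h ` insert {x} Q" by (auto simp: P_def)
    qed
    then have "card (nbrs G x) \<le> card (h ` insert {x} Q)"
      using finQ by (intro card_mono) auto
    also have "\<dots> \<le> card (insert {x} Q)" using finQ by (intro card_image_le) auto
    also have "\<dots> \<le> 1 + (k choose 2)" using finQ by (simp add: card_insert_if cQ)
    finally show ?thesis by (simp add: x)
  qed simp
  moreover have "(\<Sum>v\<in>V. card (nbrs G v)) = (\<Sum>v\<in>R. card (nbrs G v)) + (\<Sum>v\<in>h ` P. card (nbrs G v))"
    unfolding R_def using fin hV by (rule sum.subset_diff[rotated])
  ultimately have "2 * card (edges G) \<le> card R * (1 + (k choose 2)) + card A + 2 * (k choose 2)"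
    using handshake[OF G] by (simp add: V_def)
  \<comment> \<open>For \<open>k\<close> = 0, 1, 2, 3 the right-hand side equals
    \<open>card V\<close> plus 0, 0, 2, 3 respectively.\<close>
  with cases cR cA cP show ?thesis
    unfolding V_def[symmetric] by (elim disjE) (auto simp: choose_two)
qed

section \<open>The wheel\<close>

lemma verts_wheel [simp]: "verts (wheel n) = {0..n}"
  by (simp add: wheel_def)

lemma verts_delete_edges [simp]: "verts (delete_edges G B) = verts G"
  by (simp add: delete_edges_def)

lemma edges_delete_edges [simp]: "edges (delete_edges G B) = edges G - B"
  by (simp add: delete_edges_def)

lemma rim_edge_mem: "i + 1 < n \<Longrightarrow> {i, i + 1} \<in> edges (wheel n)"
  unfolding wheel_def cycle_edges_def by (force intro!: exI[of _ i])

lemma spoke_mem: "i < n \<Longrightarrow> {n, i} \<in> edges (wheel n)"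
  unfolding wheel_def by auto

lemma edges_wheel:
  "edges (wheel n) = (\<lambda>i. {i, Suc i mod n}) ` {..<n} \<union> (\<lambda>i. {n, i}) ` {..<n}"
  by (auto simp: wheel_def cycle_edges_def)

lemma simple_graph_wheel:
  assumes "n \<ge> 3"
  shows "simple_graph (wheel n)"
proof -
  have "{i, Suc i mod n} \<subseteq> {0..n} \<and> card {i, Suc i mod n} = 2" if "i < n" for i
    using assms that by (auto simp: mod_Suc)
  moreover have "{n, i} \<subseteq> {0..n} \<and> card {n, i} = 2" if "i < n" for i
    using that by auto
  ultimately show ?thesis
    unfolding simple_graph_def edges_wheel by auto
qed

lemma simple_graph_delete_edges: "simple_graph G \<Longrightarrow> simple_graph (delete_edges G B)"
  by (auto simp: simple_graph_def)

lemma card_edges_wheel: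
  assumes "n \<ge> 3"
  shows "card (edges (wheel n)) = 2 * n"
proof -
  \<comment> \<open>Two rim edges with exchanged endpoints would force \<open>n\<close> to divide 2,
    which \<open>n \<ge> 3\<close> excludes.\<close>
  have "inj_on (\<lambda>i. {i, Suc i mod n}) {..<n}"
    using assms by (auto simp: inj_on_def doubleton_eq_iff mod_Suc split: if_splits)
  moreover have "inj_on (\<lambda>i. {n, i}) {..<n}"
    by (auto simp: inj_on_def doubleton_eq_iff)
  moreover have "(\<lambda>i. {i, Suc i mod n}) ` {..<n} \<inter> (\<lambda>i. {n, i}) ` {..<n} = {}"
    by (auto simp: doubleton_eq_iff mod_Suc split: if_splits)
  ultimately show ?thesis
    unfolding edges_wheel by (simp add: card_Un_disjoint card_image)
qed

text \<open>The hub dominates the rim and any rim vertex dominates the hub. Conversely, a member of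
  a total dominating set has a neighbour in that set, and this is a second element since there are
  no loops.\<close>

lemma total_domination_number_wheel:
  assumes "n \<ge> 3"
  shows "total_domination_number (wheel n) = 2"
proof (rule antisym)
  have hub: "adjacent (wheel n) n i" if "i < n" for i
    using spoke_mem[OF that] by (simp add: adjacent_def)
  have dom: "total_dominating (wheel n) {n, 0}"
    unfolding total_dominating_def
  proof (intro conjI ballI)
    fix v assume "v \<in> verts (wheel n)"
    then consider "v < n" | "v = n" by fastforce
    then show "\<exists>u\<in>{n, 0}. adjacent (wheel n) u v"
      using hub hub[of 0] adjacent_commute[of _ 0 n] assms by cases auto
  qed auto
  then show "total_domination_number (wheel n) \<le> 2"
    using total_domination_number_le[OF _ dom] assms by simp
  show "2 \<le> total_domination_number (wheel n)"
  proof (rule total_domination_number_ge)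
    show "no_isolated (wheel n)"
      using dom unfolding no_isolated_def total_dominating_def by blast
    fix S assume S: "total_dominating (wheel n) S"
    then have fin: "finite S"
      by (auto simp: total_dominating_def intro: finite_subset)
    have "S \<noteq> {}" using S by (auto simp: total_dominating_def)
    then obtain u where u: "u \<in> S" by blast
    then obtain w where w: "w \<in> S" "adjacent (wheel n) w u"
      using S unfolding total_dominating_def by blast
    have "w \<noteq> u"
      using adjacent_imp(3)[OF simple_graph_wheel[OF assms] w(2)] .
    then have "card {w, u} = 2" by simp
    then show "2 \<le> card S"
      using card_mono[OF fin, of "{w, u}"] u w by auto
  qed simp
qed

section \<open>Bondage number from a largest surviving edge set\<close>

text \<open>Deleting few edges means keeping many: \<open>M\<close> is an admissible set of
  surviving edges of maximum size, and its complement attains the infimum.\<close>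

lemma total_bondage_numberI:
  assumes G: "finite (edges G)" and M: "M \<subseteq> edges G" "no_isolated (Graph (verts G) M)"
      "total_domination_number G + k \<le> total_domination_number (Graph (verts G) M)"
    and max: "\<And>B. B \<subseteq> edges G \<Longrightarrow> no_isolated (delete_edges G B) \<Longrightarrow>
      total_domination_number G + k \<le> total_domination_number (delete_edges G B) \<Longrightarrow>
      card (edges G - B) \<le> card M"
  shows "total_bondage_number k G = enat (card (edges G) - card M)"
  unfolding total_bondage_number_def
proof (rule antisym)
  have "delete_edges G (edges G - M) = Graph (verts G) M"
    using M(1) by (simp add: delete_edges_def double_diff)
  moreover have "card (edges G - M) = card (edges G) - card M"
    using M(1) G by (meson card_Diff_subset finite_subset)
  ultimately show "(INF B \<in> {B. B \<subseteq> edges G \<and> no_isolated (delete_edges G B) \<and>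
      total_domination_number (delete_edges G B) \<ge> total_domination_number G + k}. enat (card B))
      \<le> enat (card (edges G) - card M)"
    using M by (intro INF_lower2[of "edges G - M"]) auto
  show "enat (card (edges G) - card M) \<le> (INF B \<in> {B. B \<subseteq> edges G \<and> no_isolated (delete_edges G B) \<and>
      total_domination_number (delete_edges G B) \<ge> total_domination_number G + k}. enat (card B))"
  proof (rule INF_greatest)
    fix B assume B: "B \<in> {B. B \<subseteq> edges G \<and> no_isolated (delete_edges G B) \<and>
      total_domination_number (delete_edges G B) \<ge> total_domination_number G + k}"
    then have "card (edges G - B) \<le> card M" using max by blast
    moreover have "card (edges G - B) = card (edges G) - card B"
      using B G by (intro card_Diff_subset) (auto intro: finite_subset)
    ultimately show "enat (card (edges G) - card M) \<le> enat (card B)" by simp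
  qed
qed

section \<open>Extremal spanning subgraphs of the wheel\<close>

text \<open>The spoke to 0 and every second edge of the rim path from 1 to
  \<open>n - 1 = 2 * m\<close> form a perfect matching. Each vertex is the only neighbour of its
  partner, so a total dominating set must contain all vertices.\<close>

lemma odd_wheel_extremal:
  assumes "n = 2 * m + 1"
  defines "M \<equiv> insert {n, 0} ((\<lambda>j. {2 * j + 1, 2 * j + 2}) ` {..<m})"
  shows "M \<subseteq> edges (wheel n)" "card M = m + 1" "no_isolated (Graph {0..n} M)"
    "n + 1 \<le> total_domination_number (Graph {0..n} M)"
proof -
  let ?G = "Graph {0..n} M"
  show "M \<subseteq> edges (wheel n)"
    using spoke_mem[of 0 n] rim_edge_mem[of "2 * j + 1" n for j] assms(1)
    by (auto simp: M_def)
  have "inj_on (\<lambda>j::nat. {2 * j + 1, 2 * j + 2}) {..<m}"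
    by (auto simp: inj_on_def doubleton_eq_iff)
  moreover have "{n, 0} \<notin> (\<lambda>j. {2 * j + 1, 2 * j + 2}) ` {..<m}"
    by (auto simp: doubleton_eq_iff)
  ultimately show "card M = m + 1"
    by (simp add: M_def card_image)
  have adj: "adjacent ?G a b \<longleftrightarrow> a = n \<and> b = 0 \<or> a = 0 \<and> b = n \<or>
      (\<exists>j<m. a = 2 * j + 1 \<and> b = 2 * j + 2 \<or> a = 2 * j + 2 \<and> b = 2 * j + 1)" for a b
    unfolding adjacent_def M_def by (auto simp: doubleton_eq_iff)
  \<comment> \<open>These facts separate the matching edges from each other, so that
    \<open>metis\<close> can evaluate adjacency without arithmetic.\<close>
  have arith: "2 * i + 2 \<noteq> 2 * j + 1" "2 * i + 2 = 2 * j + 2 \<longleftrightarrow> i = j"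
    "2 * i + 1 = 2 * j + 1 \<longleftrightarrow> i = j" "n \<noteq> 0" "2 * j + 1 \<noteq> 0" "2 * j + 2 \<noteq> 0"
    "j < m \<Longrightarrow> n \<noteq> 2 * j + 1" "j < m \<Longrightarrow> n \<noteq> 2 * j + 2" for i j :: nat
    using assms(1) by presburger+
  have mate: "\<exists>u\<in>{0..n}. \<forall>w. adjacent ?G w u \<longleftrightarrow> w = v" if "v \<in> {0..n}" for v
  proof -
    have "v = 0 \<or> v = n \<or> (\<exists>j<m. v = 2 * j + 1) \<or> (\<exists>j<m. v = 2 * j + 2)"
      using that assms(1) unfolding atLeastAtMost_iff by presburger
    then consider "v = 0" | "v = n" | j where "j < m" "v = 2 * j + 1" | j where "j < m" "v = 2 * j + 2"
      by blast
    then show ?thesis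
    proof cases
      case 1
      then have "\<forall>w. adjacent ?G w n \<longleftrightarrow> w = v"
        unfolding adj using arith by metis
      then show ?thesis by (intro bexI[of _ n]) auto
    next
      case 2
      then have "\<forall>w. adjacent ?G w 0 \<longleftrightarrow> w = v"
        unfolding adj using arith by metis
      then show ?thesis by (intro bexI[of _ 0]) auto
    next
      case 3
      then have "\<forall>w. adjacent ?G w (2 * j + 2) \<longleftrightarrow> w = v"
        unfolding adj using arith by metis
      then show ?thesis using 3 assms(1) by (intro bexI[of _ "2 * j + 2"]) auto
    next
      case 4
      then have "\<forall>w. adjacent ?G w (2 * j + 1) \<longleftrightarrow> w = v"
        unfolding adj using arith by metis
      then show ?thesis using 4 assms(1) by (intro bexI[of _ "2 * j + 1"]) auto
    qed
  qed
  show iso: "no_isolated ?G"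
    unfolding no_isolated_def
  proof
    fix v assume "v \<in> verts ?G"
    then obtain u where "u \<in> {0..n}" "adjacent ?G v u" using mate[of v] by auto
    then show "\<exists>u\<in>verts ?G. adjacent ?G u v" using adjacent_commute[of ?G] by auto
  qed
  show "n + 1 \<le> total_domination_number ?G"
  proof (rule total_domination_number_ge)
    fix S assume S: "total_dominating ?G S"
    have "{0..n} \<subseteq> S"
    proof
      fix v assume "v \<in> {0..n}"
      then show "v \<in> S" using mate[of v] S unfolding total_dominating_def by auto
    qed
    moreover have "S \<subseteq> {0..n}" using S by (simp add: total_dominating_def)
    ultimately have "S = {0..n}" by blast
    then show "n + 1 \<le> card S" by simp
  qed (use iso in auto)
qed

text \<open>The hub and the rim vertices 0 and 1 form a triangle, and the path from 2 to
  \<open>n - 1 = 2 * m + 1\<close> is perfectly matched. A total dominating set contains the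
  \<open>n - 2\<close> matched vertices and at least two of the triangle.\<close>

lemma even_wheel_extremal:
  assumes "n = 2 * m + 2"
  defines "M \<equiv> {{n, 0}, {n, 1}, {0, 1}} \<union> (\<lambda>j. {2 * j + 2, 2 * j + 3}) ` {..<m}"
  shows "M \<subseteq> edges (wheel n)" "card M = m + 3" "no_isolated (Graph {0..n} M)"
    "n \<le> total_domination_number (Graph {0..n} M)"
proof -
  let ?G = "Graph {0..n} M"
  show "M \<subseteq> edges (wheel n)"
    using spoke_mem[of 0 n] spoke_mem[of 1 n] rim_edge_mem[of 0 n]
      rim_edge_mem[of "2 * j + 2" n for j] assms(1)
    by (auto simp: M_def numeral_eq_Suc)
  have "inj_on (\<lambda>j::nat. {2 * j + 2, 2 * j + 3}) {..<m}"
    by (auto simp: inj_on_def doubleton_eq_iff)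
  moreover have "{{n, 0}, {n, 1}, {0, 1}} \<inter> (\<lambda>j. {2 * j + 2, 2 * j + 3}) ` {..<m} = {}"
    by (auto simp: doubleton_eq_iff)
  moreover have "card {{n, 0}, {n, 1}, {0, 1}} = 3"
    using assms(1) by (auto simp: doubleton_eq_iff card_insert_if)
  ultimately show "card M = m + 3"
    unfolding M_def by (subst card_Un_disjoint) (auto simp: card_image)
  have adj: "adjacent ?G a b \<longleftrightarrow> {a, b} \<in> {{n, 0}, {n, 1}, {0, 1}} \<or>
      (\<exists>j<m. a = 2 * j + 2 \<and> b = 2 * j + 3 \<or> a = 2 * j + 3 \<and> b = 2 * j + 2)" for a b
    unfolding adjacent_def M_def by (auto simp: doubleton_eq_iff)
  have arith: "2 * i + 2 \<noteq> 2 * j + 3" "2 * i + 2 = 2 * j + 2 \<longleftrightarrow> i = j"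
    "2 * i + 3 = 2 * j + 3 \<longleftrightarrow> i = j"
    \<comment> \<open>No triangle edge meets a matched vertex, so the two kinds of adjacency do not
      interfere.\<close>
    "j < m \<Longrightarrow> {a, 2 * j + 2} \<notin> {{n, 0}, {n, 1}, {0, 1}}"
    "j < m \<Longrightarrow> {a, 2 * j + 3} \<notin> {{n, 0}, {n, 1}, {0, 1}}" for i j a :: nat
    using assms(1) by (presburger | auto simp: doubleton_eq_iff; presburger)+
  have mate: "\<exists>u\<in>{0..n}. \<forall>w. adjacent ?G w u \<longleftrightarrow> w = v" if "v \<in> {2..<n}" for v
  proof -
    have "(\<exists>j<m. v = 2 * j + 2) \<or> (\<exists>j<m. v = 2 * j + 3)"
      using that assms(1) unfolding atLeastLessThan_iff by presburger
    then consider j where "j < m" "v = 2 * j + 2" | j where "j < m" "v = 2 * j + 3"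
      by blast
    then show ?thesis
    proof cases
      case 1
      then have "\<forall>w. adjacent ?G w (2 * j + 3) \<longleftrightarrow> w = v"
        unfolding adj using arith by metis
      then show ?thesis using 1 assms(1) by (intro bexI[of _ "2 * j + 3"]) auto
    next
      case 2
      then have "\<forall>w. adjacent ?G w (2 * j + 2) \<longleftrightarrow> w = v"
        unfolding adj using arith by metis
      then show ?thesis using 2 assms(1) by (intro bexI[of _ "2 * j + 2"]) auto
    qed
  qed
  have tri: "adjacent ?G w 0 \<longleftrightarrow> w = 1 \<or> w = n" "adjacent ?G w 1 \<longleftrightarrow> w = 0 \<or> w = n"
    "adjacent ?G w n \<longleftrightarrow> w = 0 \<or> w = 1" for w
    using assms(1) by (auto simp: adjacent_def M_def doubleton_eq_iff)
  show iso: "no_isolated ?G"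
    unfolding no_isolated_def
  proof
    fix v assume "v \<in> verts ?G"
    then consider "v = 0" | "v = 1" | "v = n" | "v \<in> {2..<n}" by fastforce
    then show "\<exists>u\<in>verts ?G. adjacent ?G u v"
    proof cases
      case 4
      then obtain u where "u \<in> {0..n}" "adjacent ?G v u" using mate[of v] by auto
      then show ?thesis using adjacent_commute[of ?G] by auto
    qed (use tri(1)[of n] tri(2)[of n] tri(3)[of 0] in auto)
  qed
  show "n \<le> total_domination_number ?G"
  proof (rule total_domination_number_ge)
    fix S assume S: "total_dominating ?G S"
    have fin: "finite S" using S by (auto simp: total_dominating_def intro: finite_subset)
    have sub: "{2..<n} \<subseteq> S"
    proof
      fix v assume "v \<in> {2..<n}"
      then show "v \<in> S" using mate[of v] S unfolding total_dominating_def by auto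
    qed
    have dom: "\<exists>u\<in>S. adjacent ?G u v" if "v \<le> n" for v
      using S that by (simp add: total_dominating_def)
    \<comment> \<open>Each triangle vertex must be dominated by one of the other two, so
      \<open>S\<close> meets every pair of them and misses at most one.\<close>
    have "1 \<in> S \<or> n \<in> S" "0 \<in> S \<or> n \<in> S" "0 \<in> S \<or> 1 \<in> S"
      using dom[of 0] dom[of 1] dom[of n] assms(1) unfolding tri by auto
    moreover have "n \<noteq> 0" "n \<noteq> 1" using assms(1) by auto
    ultimately have "\<exists>a\<in>S. \<exists>b\<in>S. a \<noteq> b \<and> a \<in> {0, 1, n} \<and> b \<in> {0, 1, n}"
      by (metis insertCI zero_neq_one)
    then obtain a b where "a \<in> S" "b \<in> S" "a \<noteq> b" "a \<notin> {2..<n}" "b \<notin> {2..<n}"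
      by auto
    then have "card ({2..<n} \<union> {a, b}) = n"
      using assms(1) by (subst card_Un_disjoint) auto
    moreover have "{2..<n} \<union> {a, b} \<subseteq> S" using sub \<open>a \<in> S\<close> \<open>b \<in> S\<close> by blast
    ultimately show "n \<le> card S" using card_mono[OF fin] by metis
  qed (use iso in auto)
qed

theorem theorem3p8:
  fixes n :: nat
  assumes "n \<ge> 3"
  shows "(even n \<longrightarrow>
            (\<forall>B. B \<subseteq> edges (wheel n) \<and> no_isolated (delete_edges (wheel n) B) \<longrightarrow>
               total_domination_number (delete_edges (wheel n) B)
                 \<le> total_domination_number (wheel n) + (n - 2)) \<and>
            total_bondage_number (n - 2) (wheel n) = enat (2 * n - (n + 4) div 2)) \<and>
         (odd n \<longrightarrow>
            (\<forall>B. B \<subseteq> edges (wheel n) \<and> no_isolated (delete_edges (wheel n) B) \<longrightarrow>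
               total_domination_number (delete_edges (wheel n) B)
                 \<le> total_domination_number (wheel n) + (n - 1)) \<and>
            total_bondage_number (n - 1) (wheel n) = enat (2 * n - (n + 1) div 2))"
proof -
  note simple = simple_graph_wheel[OF assms]
  note simple_del = simple_graph_delete_edges[OF simple]
  note fin = simple_graph_finite_edges[OF simple]
  note gamma = total_domination_number_wheel[OF assms]
  \<comment> \<open>The whole vertex set is total dominating. As \<open>2 + (n - 1) = n + 1\<close>,
    this is already the bound for odd \<open>n\<close>.\<close>
  have le: "total_domination_number (delete_edges (wheel n) B) \<le> n + 1"
    if "no_isolated (delete_edges (wheel n) B)" for B
    using total_domination_number_le[OF _ total_dominating_verts[OF that]] by simp
  show ?thesis
  proof (intro conjI impI)
    assume "even n"
    show "\<forall>B. B \<subseteq> edges (wheel n) \<and> no_isolated (delete_edges (wheel n) B) \<longrightarrow>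
        total_domination_number (delete_edges (wheel n) B)
          \<le> total_domination_number (wheel n) + (n - 2)"
    proof (intro allI impI, elim conjE)
      fix B assume iso: "no_isolated (delete_edges (wheel n) B)"
      \<comment> \<open>The value \<open>n + 1\<close> would make \<open>n + 1\<close> twice the
        number of edges, impossible for even \<open>n\<close>.\<close>
      have "\<not> n + 1 \<le> total_domination_number (delete_edges (wheel n) B)"
        using card_edges_if_total_domination_number_max[OF simple_del iso] \<open>even n\<close>
        by (metis Suc_eq_plus1 card_atLeastAtMost diff_zero dvd_triv_left even_Suc
            verts_delete_edges verts_wheel)
      then show "total_domination_number (delete_edges (wheel n) B)
          \<le> total_domination_number (wheel n) + (n - 2)"
        using gamma assms by linarith
    qed
    obtain m where m: "n = 2 * m + 2"
    proof
      show "n = 2 * ((n - 2) div 2) + 2"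
        using \<open>even n\<close> assms by presburger
    qed
    note M = even_wheel_extremal[OF m]
    have "2 * n - (n + 4) div 2 = card (edges (wheel n)) - (m + 3)"
      using m card_edges_wheel[OF assms] by simp
    then show "total_bondage_number (n - 2) (wheel n) = enat (2 * n - (n + 4) div 2)"
      \<comment> \<open>The number \<open>m + 3 = (n + 4) div 2\<close> is turned back into the size
        of the extremal edge set, to match \<open>total_bondage_numberI\<close>.\<close>
      unfolding M(2)[symmetric]
    proof (simp only:, intro total_bondage_numberI[OF fin M(1)])
      fix B assume "no_isolated (delete_edges (wheel n) B)"
        "total_domination_number (wheel n) + (n - 2) \<le> total_domination_number (delete_edges (wheel n) B)"
      \<comment> \<open>The total domination number is at least \<open>2 + (n - 2) = n\<close>, one
        less than the number of vertices, so twice the number of surviving edges is at most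
        \<open>(n + 1) + 3 = 2 * (m + 3)\<close>.\<close>
      then show "card (edges (wheel n) - B) \<le>
          card ({{n, 0}, {n, 1}, {0, 1}} \<union> (\<lambda>j. {2 * j + 2, 2 * j + 3}) ` {..<m})"
        unfolding M(2)
        using card_edges_if_total_domination_number_near_max[OF simple_del, of B] gamma assms m
        by simp
    qed (use M gamma assms in simp_all)
  next
    assume "odd n"
    show "\<forall>B. B \<subseteq> edges (wheel n) \<and> no_isolated (delete_edges (wheel n) B) \<longrightarrow>
        total_domination_number (delete_edges (wheel n) B)
          \<le> total_domination_number (wheel n) + (n - 1)"
      using le gamma assms by fastforce
    obtain m where m: "n = 2 * m + 1" using \<open>odd n\<close> by (elim oddE)
    note M = odd_wheel_extremal[OF m]
    have "2 * n - (n + 1) div 2 = card (edges (wheel n)) - (m + 1)"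
      using m card_edges_wheel[OF assms] by simp
    then show "total_bondage_number (n - 1) (wheel n) = enat (2 * n - (n + 1) div 2)"
      unfolding M(2)[symmetric]
    proof (simp only:, intro total_bondage_numberI[OF fin M(1)])
      fix B assume "no_isolated (delete_edges (wheel n) B)"
        "total_domination_number (wheel n) + (n - 1) \<le> total_domination_number (delete_edges (wheel n) B)"
      \<comment> \<open>Here the total domination number reaches the number of vertices
        \<open>n + 1\<close>, so exactly \<open>(n + 1) div 2 = m + 1\<close> edges survive.\<close>
      then show "card (edges (wheel n) - B) \<le>
          card (insert {n, 0} ((\<lambda>j. {2 * j + 1, 2 * j + 2}) ` {..<m}))"
        unfolding M(2)
        using card_edges_if_total_domination_number_max[OF simple_del, of B] gamma assms m
        by simp
    qed (use M gamma assms in simp_all)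
  qed
qed

end
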